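(* Let $|N|\geq 4$ and $|O|=3$. Then the random serial dictatorship mechanism RSD is at-most-$\frac{1}{4}$-object-wasteful.
   Context: Model. $N=\{1,\ldots,n\}$ is a finite set of agents and $O$ a finite set of objects. Each agent $i$ has a strict preference $R_i$, a linear order over $O\cup\{i\}$, where $i$ stands for being unassigned; $P_i$ is its asymmetric part, and $o\in O$ is acceptable to $i$ if $oP_ii$. $\mathcal{R}^N$ is the set of all profiles $R=(R_i)_{i\in N}$ of such linear orders. An assignment is a map $\mu$ on $N$ with $\mu_i\in O\cup\{i\}$ for all $i$ and $\mu_i\neq\mu_j$ for $i\neq j$; $\mathcal{M}$ is the set of assignments and $\Delta(\mathcal{M})$ the set of probability distributions over it. A mechanism is a map $f:\mathcal{R}^N\to\Delta(\mathcal{M})$; $f_{ia}(R)$ is the probability that $i$ is assigned $a\in O\cup\{i\}$ under $f(R)$, and $f_{oo}(R)=1-\sum_{j\in N}f_{jo}(R)$ for $o\in O$. RSD. For a strict priority order $\succ$ over $N$, the serial dictatorship $f^{\succ}$ lets agents choose one after another in the order $\succ$; each agent receives his most preferred element among his outside option and the objects not chosen by earlier agents. With $\Pi$ the set of all strict priority orders over $N$, $RSD(R)=\frac{1}{n!}\sum_{\succ\in\Pi}f^{\succ}(R)$ for all $R$. Waste. For $q\in[0,1]$, $f$ is $q$-object-wasteful if there exist a profile $R$ and $o\in O$ with $\min\{\sum_{i\in N:\,oP_ii}f_{ii}(R),\,f_{oo}(R)\}\ge q$. $f$ is at-most-$q$-object-wasteful if $f$ is $q$-object-wasteful and not $q'$-object-wasteful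 for any $q'>q$. *)

theory Defs
  imports "HOL-Probability.Probability" "HOL-Combinatorics.Multiset_Permutations"
begin

text \<open>
  The agents are the elements of a finite type \<open>'i\<close>, the objects those of a finite type \<open>'o\<close>.
  For agent \<open>i\<close>, the set \<open>O \<union> {i}\<close> is represented by \<open>'o option\<close>: \<open>Some x\<close> is the object \<open>x\<close>
  and \<open>None\<close> is the agent's own outside option \<open>i\<close>. Hence \<open>None\<close> stands for different
  elements of \<open>O \<union> N\<close> for different agents.
  A pair \<open>(a, b) \<in> R i\<close> means that agent \<open>i\<close> likes \<open>a\<close> at least as much as \<open>b\<close>.
\<close>

type_synonym ('i, 'o) profile = "'i \<Rightarrow> ('o option \<times> 'o option) set"
type_synonym ('i, 'o) assignment = "'i \<Rightarrow> 'o option"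
type_synonym ('i, 'o) random_rule = "('i, 'o) profile \<Rightarrow> ('i, 'o) assignment pmf"

definition profiles :: "('i, 'o) profile set" where
  "profiles = {R. \<forall>i. linear_order (R i)}"

definition strictly_prefers :: "('i, 'o) profile \<Rightarrow> 'i \<Rightarrow> 'o option \<Rightarrow> 'o option \<Rightarrow> bool" where
  "strictly_prefers R i a b \<longleftrightarrow> (a, b) \<in> R i \<and> (b, a) \<notin> R i"

definition acceptable :: "('i, 'o) profile \<Rightarrow> 'i \<Rightarrow> 'o \<Rightarrow> bool" where
  "acceptable R i x \<longleftrightarrow> strictly_prefers R i (Some x) None"

text \<open>Outside options of different agents are different elements, so several agents may have \<open>None\<close>.\<close>

definition assignments :: "('i, 'o) assignment set" where
  "assignments = {\<mu>. \<forall>i j. i \<noteq> j \<longrightarrow> \<mu> i \<noteq> None \<longrightarrow> \<mu> i \<noteq> \<mu> j}"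

definition mechanism :: "('i, 'o) random_rule \<Rightarrow> bool" where
  "mechanism f \<longleftrightarrow> (\<forall>R\<in>profiles. set_pmf (f R) \<subseteq> assignments)"

definition assign_prob :: "('i, 'o) random_rule \<Rightarrow> ('i, 'o) profile \<Rightarrow> 'i \<Rightarrow> 'o option \<Rightarrow> real" where
  "assign_prob f R i a = measure_pmf.prob (f R) {\<mu>. \<mu> i = a}"

definition unassigned_prob :: "('i::finite, 'o) random_rule \<Rightarrow> ('i, 'o) profile \<Rightarrow> 'o \<Rightarrow> real" where
  "unassigned_prob f R x = 1 - (\<Sum>j\<in>UNIV. assign_prob f R j (Some x))"

definition best :: "('i, 'o) profile \<Rightarrow> 'i \<Rightarrow> 'o option set \<Rightarrow> 'o option" where
  "best R i S = (THE a. a \<in> S \<and> (\<forall>b\<in>S. (a, b) \<in> R i))"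

text \<open>
  A strict priority order is represented by the list of all agents, highest priority first.
  The set \<open>A\<close> contains the objects that are still available; agents not in the list get \<open>None\<close>.
\<close>

fun serial_choice :: "('i, 'o) profile \<Rightarrow> 'i list \<Rightarrow> 'o set \<Rightarrow> ('i, 'o) assignment" where
  "serial_choice R [] A = (\<lambda>_. None)"
| "serial_choice R (i # p) A =
     (let a = best R i (insert None (Some ` A))
      in (serial_choice R p (A - set_option a))(i := a))"

definition priority_orders :: "'i list set" where
  "priority_orders = permutations_of_set UNIV"

definition serial_dictatorship :: "'i list \<Rightarrow> ('i, 'o) profile \<Rightarrow> ('i, 'o) assignment" where
  "serial_dictatorship p R = serial_choice R p UNIV"

definition RSD :: "('i::finite, 'o::finite) random_rule" where
  "RSD R = map_pmf (\<lambda>p. serial_dictatorship p R) (pmf_of_set priority_orders)"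

definition object_wasteful :: "real \<Rightarrow> ('i::finite, 'o) random_rule \<Rightarrow> bool" where
  "object_wasteful q f \<longleftrightarrow>
     (\<exists>R\<in>profiles. \<exists>x.
        min (\<Sum>i | acceptable R i x. assign_prob f R i None) (unassigned_prob f R x) \<ge> q)"

definition at_most_object_wasteful :: "real \<Rightarrow> ('i::finite, 'o) random_rule \<Rightarrow> bool" where
  "at_most_object_wasteful q f \<longleftrightarrow>
     object_wasteful q f \<and> (\<forall>q'. q < q' \<and> q' \<le> 1 \<longrightarrow> \<not> object_wasteful q' f)"

lemma finite_priority_orders: "finite (priority_orders :: 'i::finite list set)"
  by (simp add: priority_orders_def)

lemma priority_orders_nonempty: "(priority_orders :: 'i::finite list set) \<noteq> {}"
  by (simp add: priority_orders_def)

lemma card_priority_orders: "card (priority_orders :: 'i::finite list set) = fact CARD('i)"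
  by (simp add: priority_orders_def)

text \<open>\<open>RSD\<close> is the average of the serial dictatorships over all priority orders.\<close>

lemma pmf_RSD:
  fixes R :: "('i::finite, 'o::finite) profile"
  shows "pmf (RSD R) \<mu> =
    (1 / fact CARD('i)) * (\<Sum>p\<in>priority_orders. pmf (return_pmf (serial_dictatorship p R)) \<mu>)"
proof -
  have "pmf (RSD R) \<mu> =
      measure_pmf.expectation (pmf_of_set priority_orders)
        (\<lambda>p. pmf (return_pmf (serial_dictatorship p R)) \<mu>)"
    unfolding RSD_def map_pmf_def by (simp add: pmf_bind)
  also have "\<dots> = (\<Sum>p\<in>priority_orders. pmf (return_pmf (serial_dictatorship p R)) \<mu>)
      / fact CARD('i)"
    by (subst integral_pmf_of_set)
       (simp_all add: finite_priority_orders priority_orders_nonempty card_priority_orders)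
  finally show ?thesis by simp
qed

lemma linear_order_best_exists:
  assumes "linear_order r" "finite S" "S \<noteq> {}"
  shows "\<exists>!a. a \<in> S \<and> (\<forall>b\<in>S. (a, b) \<in> r)"
proof -
  have refl: "(a, a) \<in> r" for a
    using assms(1) by (auto simp: order_on_defs refl_on_def)
  have tr: "trans r" and anti: "antisym r" and tot: "total r"
    using assms(1) by (auto simp: order_on_defs)
  have total: "(a, b) \<in> r \<or> (b, a) \<in> r" for a b
    using refl tot by (cases "a = b") (auto simp: total_on_def)
  have "\<exists>a. a \<in> S \<and> (\<forall>b\<in>S. (a, b) \<in> r)"
    using assms(2,3)
  proof (induction rule: finite_ne_induct)
    case (singleton x)
    then show ?case using refl by auto
  next
    case (insert x F)
    then obtain a where a: "a \<in> F" "\<forall>b\<in>F. (a, b) \<in> r" by blast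
    show ?case
    proof (cases "(a, x) \<in> r")
      case True
      then show ?thesis using a by blast
    next
      case False
      then have "(x, a) \<in> r" using total by blast
      then have "\<forall>b\<in>insert x F. (x, b) \<in> r" using a tr refl by (auto dest: transD)
      then show ?thesis by blast
    qed
  qed
  then show ?thesis using anti by (auto dest: antisymD)
qed

lemma best_greatest:
  fixes R :: "('i, 'o::finite) profile"
  assumes "R \<in> profiles" "S \<noteq> {}"
  shows "best R i S \<in> S" and "b \<in> S \<Longrightarrow> (best R i S, b) \<in> R i"
  using theI'[OF linear_order_best_exists[of "R i" S]] assms
  unfolding best_def profiles_def by auto

lemma serial_choice_available:
  fixes R :: "('i, 'o::finite) profile"
  assumes "R \<in> profiles" "serial_choice R p A i = Some x"
  shows "x \<in> A"
  using assms(2)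
proof (induction p arbitrary: A)
  case (Cons j p)
  show ?case
    using Cons best_greatest(1)[OF assms(1), of "insert None (Some ` A)" j]
    by (auto simp: Let_def split: if_splits)
qed simp

lemma serial_choice_assignment:
  fixes R :: "('i, 'o::finite) profile"
  assumes "R \<in> profiles"
  shows "serial_choice R p A \<in> assignments"
proof (induction p arbitrary: A)
  case Nil
  show ?case by (simp add: assignments_def)
next
  case (Cons j p)
  define a where "a = best R j (insert None (Some ` A))"
  have "serial_choice R p (A - set_option a) \<in> assignments" by (rule Cons)
  moreover have "serial_choice R p (A - set_option a) i \<noteq> a" if "a \<noteq> None" for i
    using that serial_choice_available[OF assms, of p "A - set_option a" i] by force
  ultimately show ?case
    unfolding assignments_def serial_choice.simps Let_def a_def[symmetric]
    by (auto split: if_splits) metis+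
qed

lemma mechanism_RSD: "mechanism (RSD :: ('i::finite, 'o::finite) random_rule)"
  unfolding mechanism_def RSD_def serial_dictatorship_def
  using serial_choice_assignment by auto

end

theory Submission
  imports Defs
begin

text \<open>
  Suppose that the object \<open>x\<close> is unassigned under some order and that an agent \<open>i\<close> accepting \<open>x\<close>
  is unassigned under another one. Then exactly two agents \<open>i\<close>, \<open>j\<close> accept \<open>x\<close>, and two further
  agents \<open>c\<close>, \<open>d\<close> accept the other objects \<open>y\<close>, \<open>z\<close> respectively. Whenever \<open>x\<close> stays unassigned,
  \<open>i\<close> and \<open>j\<close> share \<open>y\<close> and \<open>z\<close>, the earlier of them receiving the one he prefers, and the takers of
  \<open>y\<close> and \<open>z\<close> precede \<open>c\<close> and \<open>d\<close>. If \<open>i\<close> is the earlier one, this leaves three of the 24 relative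
  orders of the four agents, and likewise for \<open>j\<close>, so \<open>x\<close> is unassigned with probability at most
  \<open>6/24\<close>.

  The bound is attained when \<open>i\<close> ranks \<open>y\<close> over \<open>x\<close>, \<open>j\<close> ranks \<open>z\<close> over \<open>x\<close>, \<open>c\<close> accepts only \<open>y\<close>,
  \<open>d\<close> accepts only \<open>z\<close>, and no further agent accepts anything: \<open>x\<close> is unassigned iff \<open>i\<close> precedes \<open>c\<close>
  and \<open>j\<close> precedes \<open>d\<close>, and \<open>i\<close> or \<open>j\<close> is unassigned iff \<open>c\<close> precedes \<open>i\<close> and \<open>d\<close> precedes \<open>j\<close>.
\<close>

section \<open>Precedence in lists and the relative order of a subset of agents\<close>

primrec precedes :: "'a list \<Rightarrow> 'a \<Rightarrow> 'a \<Rightarrow> bool" where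
  "precedes [] j i = False"
| "precedes (h # p) j i = (h = j \<and> i \<in> set p \<or> precedes p j i)"

lemma precedes_in_set: "precedes p j i \<Longrightarrow> j \<in> set p \<and> i \<in> set p"
  by (induction p) auto

lemma precedes_filter: "P j \<Longrightarrow> P i \<Longrightarrow> precedes (filter P p) j i = precedes p j i"
  by (induction p) auto

lemma precedes_total: "i \<in> set p \<Longrightarrow> j \<in> set p \<Longrightarrow> i \<noteq> j \<Longrightarrow> precedes p i j \<or> precedes p j i"
  by (induction p) auto

lemma precedes_asym: "distinct p \<Longrightarrow> precedes p i j \<Longrightarrow> \<not> precedes p j i"
  by (induction p) (auto dest: precedes_in_set)

text \<open>Restricting a uniformly random order of all agents to \<open>S\<close> gives a uniformly
  random order of \<open>S\<close>, so events about relative order reduce to counting lists.\<close>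

lemma prob_priority_orders_filter:
  fixes S :: "'i::finite set"
  assumes "L \<subseteq> permutations_of_set S"
  shows "measure_pmf.prob (pmf_of_set priority_orders) {p. filter (\<lambda>v. v \<in> S) p \<in> L}
    = card L / fact (card S)"
proof -
  have "map_pmf (filter (\<lambda>v. v \<in> S)) (pmf_of_set priority_orders)
      = map_pmf fst (map_pmf (partition (\<lambda>v. v \<in> S)) (pmf_of_set (permutations_of_set UNIV)))"
    by (simp add: priority_orders_def map_pmf_comp o_def)
  also have "\<dots> = pmf_of_set (permutations_of_set S)"
    by (subst partition_random_permutations) (simp_all add: map_fst_pair_pmf)
  finally have "measure_pmf.prob (pmf_of_set priority_orders) {p. filter (\<lambda>v. v \<in> S) p \<in> L}
      = measure_pmf.prob (pmf_of_set (permutations_of_set S)) L"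
    by (metis measure_map_pmf vimage_def)
  also have "\<dots> = card L / fact (card S)"
    using assms by (simp add: measure_pmf_of_set Int_absorb1)
  finally show ?thesis .
qed

section \<open>Strict preferences and envy in serial dictatorships\<close>

lemma strictly_prefers_iff:
  assumes "R \<in> profiles"
  shows "strictly_prefers R i a b \<longleftrightarrow> (a, b) \<in> R i \<and> a \<noteq> b"
  using assms unfolding strictly_prefers_def profiles_def order_on_defs refl_on_def antisym_def
  by auto

lemma strictly_prefers_linear:
  assumes "R \<in> profiles"
  shows "a = b \<or> strictly_prefers R i a b \<or> strictly_prefers R i b a"
  unfolding strictly_prefers_iff[OF assms]
  using assms unfolding profiles_def order_on_defs total_on_def by auto

lemma strictly_prefers_trans:
  assumes "R \<in> profiles" "strictly_prefers R i a b" "strictly_prefers R i b c"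
  shows "strictly_prefers R i a c"
  using assms unfolding strictly_prefers_def profiles_def order_on_defs
  by (auto dest: transD)

lemma serial_choice_individually_rational:
  fixes R :: "('i, 'o::finite) profile"
  assumes "R \<in> profiles"
  shows "(serial_choice R p A i, None) \<in> R i"
proof (induction p arbitrary: A)
  case Nil
  show ?case using assms by (auto simp: profiles_def order_on_defs refl_on_def)
next
  case (Cons h p)
  then show ?case using best_greatest(2)[OF assms, of "insert None (Some ` A)" None]
    by (auto simp: Let_def)
qed

text \<open>Each agent takes the best of what is left, so an object of \<open>A\<close> that he
  prefers to his own outcome must be gone at his turn, hence in the hands of a predecessor.\<close>

lemma serial_choice_envied_precedes:
  fixes R :: "('i, 'o::finite) profile"
  assumes "R \<in> profiles" "distinct p" "i \<in> set p" "x \<in> A"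
    and "strictly_prefers R i (Some x) (serial_choice R p A i)"
  shows "\<exists>j. precedes p j i \<and> serial_choice R p A j = Some x"
  using assms(2-)
proof (induction p arbitrary: A)
  case (Cons h p)
  define a where "a = best R h (insert None (Some ` A))"
  show ?case
  proof (cases "h = i")
    case True
    then have "(serial_choice R (h # p) A i, Some x) \<in> R i"
      using best_greatest(2)[OF assms(1), of "insert None (Some ` A)" "Some x" h] Cons.prems
      by (simp add: Let_def)
    then show ?thesis using Cons.prems by (simp add: strictly_prefers_def)
  next
    case False
    show ?thesis
    proof (cases "a = Some x")
      case True
      then show ?thesis using Cons.prems False by (auto simp: Let_def a_def intro!: exI[of _ h])
    next
      case neq: False
      then obtain j where j: "precedes p j i" "serial_choice R p (A - set_option a) j = Some x"
        using Cons.prems False Cons.IH[of "A - set_option a"] by (auto simp: Let_def a_def)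
      \<comment> \<open>\<open>j\<close> occurs in \<open>p\<close> and \<open>h\<close> does not,
        so the update at \<open>h\<close> leaves the outcome of \<open>j\<close> unchanged.\<close>
      moreover have "j \<noteq> h" using j(1) Cons.prems(1) precedes_in_set by fastforce
      ultimately show ?thesis by (intro exI[of _ j]) (simp add: Let_def a_def)
    qed
  qed
qed simp

section \<open>RSD probabilities as events over priority orders\<close>

lemma priority_orders_iff: "p \<in> priority_orders \<longleftrightarrow> distinct p \<and> set p = UNIV"
  by (auto simp: priority_orders_def permutations_of_set_def)

lemma prob_priority_orders_restrict:
  "measure_pmf.prob (pmf_of_set priority_orders) {p :: 'i::finite list. p \<in> priority_orders \<and> Q p}
    = measure_pmf.prob (pmf_of_set priority_orders) {p. Q p}"
  by (simp add: measure_pmf_of_set finite_priority_orders priority_orders_nonempty Int_def)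

lemma assign_prob_RSD:
  "assign_prob RSD R i a = measure_pmf.prob (pmf_of_set priority_orders)
     {p. serial_dictatorship p R i = a}"
  by (simp add: assign_prob_def RSD_def vimage_def)

text \<open>No two agents receive \<open>x\<close> together, so the events of receiving it are
  disjoint and their probabilities add up to that of the union.\<close>

lemma unassigned_prob_RSD:
  fixes R :: "('i::finite, 'o::finite) profile"
  assumes "R \<in> profiles"
  shows "unassigned_prob RSD R x = measure_pmf.prob (pmf_of_set priority_orders)
     {p. \<forall>j. serial_dictatorship p R j \<noteq> Some x}"
proof -
  let ?M = "pmf_of_set (priority_orders :: 'i list set)"
  let ?E = "\<lambda>j. {p. serial_dictatorship p R j = Some x}"
  have "disjoint_family ?E"
    using serial_choice_assignment[OF assms]
    by (auto simp: disjoint_family_on_def serial_dictatorship_def assignments_def)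
      (metis option.distinct(1))
  then have "(\<Sum>j\<in>UNIV. assign_prob RSD R j (Some x)) = measure_pmf.prob ?M (\<Union>j. ?E j)"
    by (simp add: assign_prob_RSD measure_pmf.finite_measure_finite_Union)
  moreover have "{p. \<forall>j. serial_dictatorship p R j \<noteq> Some x} = UNIV - (\<Union>j. ?E j)"
    by auto
  ultimately show ?thesis
    using measure_pmf.prob_compl[of "\<Union>j. ?E j" ?M]
    by (simp add: unassigned_prob_def)
qed

lemma serial_dictatorship_envied_precedes:
  fixes R :: "('i, 'o::finite) profile"
  assumes "R \<in> profiles" "p \<in> priority_orders"
    and "strictly_prefers R i (Some x) (serial_dictatorship p R i)"
  obtains j where "precedes p j i" "serial_dictatorship p R j = Some x"
  using serial_choice_envied_precedes[OF assms(1), of p i x UNIV] assms(2,3)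
  by (auto simp: serial_dictatorship_def priority_orders_iff)

lemma serial_dictatorship_injective:
  fixes R :: "('i, 'o::finite) profile"
  assumes "R \<in> profiles" "serial_dictatorship p R i = Some x" "serial_dictatorship p R j = Some x"
  shows "i = j"
  using serial_choice_assignment[OF assms(1), of p UNIV] assms(2,3)
  unfolding serial_dictatorship_def assignments_def
  by (metis (mono_tags, lifting) mem_Collect_eq option.distinct(1))

lemma serial_dictatorship_acceptable:
  fixes R :: "('i, 'o::finite) profile"
  assumes "R \<in> profiles" "serial_dictatorship p R i = Some x"
  shows "acceptable R i x"
  using serial_choice_individually_rational[OF assms(1), of p UNIV i] assms
  by (simp add: acceptable_def strictly_prefers_iff serial_dictatorship_def)

section \<open>Relative orders of four agents\<close>

definition fork_orders :: "'a \<Rightarrow> 'a \<Rightarrow> 'a \<Rightarrow> 'a \<Rightarrow> 'a list set" where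
  "fork_orders i j c d = {[i, j, c, d], [i, j, d, c], [i, c, j, d]}"

text \<open>The six shuffles of \<open>[i, c]\<close> with \<open>[j, d]\<close>, split by whether
  \<open>i\<close> or \<open>j\<close> comes first.\<close>

definition interleavings :: "'a \<Rightarrow> 'a \<Rightarrow> 'a \<Rightarrow> 'a \<Rightarrow> 'a list set" where
  "interleavings i c j d = fork_orders i j c d \<union> fork_orders j i d c"

text \<open>The three precedences form a tree with root \<open>i\<close>, children \<open>j\<close>
  and \<open>c\<close> of \<open>i\<close>, and child \<open>d\<close> of \<open>j\<close>;
  \<open>fork_orders i j c d\<close> consists of its linear extensions.\<close>

lemma filter_mem_fork_orders:
  fixes p :: "'i::finite list"
  assumes "p \<in> priority_orders" "distinct [i, j, c, d]"
    and "precedes p i j" "precedes p i c" "precedes p j d"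
  shows "filter (\<lambda>v. v \<in> {i, j, c, d}) p \<in> fork_orders i j c d"
proof -
  let ?q = "filter (\<lambda>v. v \<in> {i, j, c, d}) p"
  have q: "set ?q = {i, j, c, d}" "distinct ?q"
    using assms(1) by (auto simp: priority_orders_iff)
  then have "length ?q = 4" using assms(2) distinct_card[of ?q] by simp
  then obtain q1 q2 q3 q4 where q4: "?q = [q1, q2, q3, q4]"
    by (auto simp: numeral_eq_Suc length_Suc_conv)
  have "precedes ?q i j" "precedes ?q i c" "precedes ?q j d"
    using assms(3-5) by (subst precedes_filter; simp)+
  then show ?thesis
    using assms(2) q unfolding q4 fork_orders_def by auto
qed

lemma filter_mem_interleavings:
  assumes "filter (\<lambda>v. v \<in> {i, c, j, d}) p \<in> interleavings i c j d"
  shows "precedes p i c" "precedes p j d"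
proof -
  have "precedes (filter (\<lambda>v. v \<in> {i, c, j, d}) p) i c"
    "precedes (filter (\<lambda>v. v \<in> {i, c, j, d}) p) j d"
    using assms unfolding interleavings_def fork_orders_def by (elim UnE insertE emptyE; simp)+
  then show "precedes p i c" "precedes p j d"
    by (simp_all add: precedes_filter)
qed

lemma prob_interleavings:
  fixes i :: "'i::finite"
  assumes "distinct [i, c, j, d]"
  shows "measure_pmf.prob (pmf_of_set priority_orders)
    {p. filter (\<lambda>v. v \<in> {i, c, j, d}) p \<in> interleavings i c j d} = 1 / 4"
proof -
  have "interleavings i c j d \<subseteq> permutations_of_set {i, c, j, d}"
    using assms by (auto simp: interleavings_def fork_orders_def permutations_of_set_def)
  moreover have "card (interleavings i c j d) = 6" "card {i, c, j, d} = 4"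
    using assms by (auto simp: interleavings_def fork_orders_def)
  ultimately show ?thesis
    using prob_priority_orders_filter[of "interleavings i c j d" "{i, c, j, d}"]
    by (simp del: insert_iff add: fact_numeral)
qed

section \<open>Upper bound on the probability that an object stays unassigned\<close>

lemma unassigned_imp_fork_order:
  fixes R :: "('i::finite, 'o::finite) profile"
  assumes R: "R \<in> profiles" and p: "p \<in> priority_orders"
    and unassigned: "\<forall>k. serial_dictatorship p R k \<noteq> Some x"
    and objects: "(UNIV :: 'o set) = {x, y, z}"
    and agents: "distinct [i, j, c, d]"
    and acc: "acceptable R i x" "acceptable R j x" "acceptable R c y" "acceptable R d z"
    and first: "precedes p i j" and pref: "strictly_prefers R i (Some y) (Some z)"
  shows "filter (\<lambda>v. v \<in> {i, j, c, d}) p \<in> fork_orders i j c d"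
proof -
  define M where "M = serial_dictatorship p R"
  note envy = serial_dictatorship_envied_precedes[OF R p, folded M_def]
  note inj = serial_dictatorship_injective[OF R, of p, folded M_def]
  have no_x: "M k \<noteq> Some x" for k using unassigned by (simp add: M_def)
  have M_cases: "M k = None \<or> M k = Some y \<or> M k = Some z" for k
    using no_x[of k] objects by (cases "M k") auto
  \<comment> \<open>An agent who accepts \<open>x\<close> but holds nothing would envy a holder of
    \<open>x\<close>, and there is none.\<close>
  have served: "M k = Some y \<or> M k = Some z" if "acceptable R k x" for k
    using envy[of k x] no_x M_cases[of k] that by (metis acceptable_def)
  have ij: "i \<noteq> j" using agents by simp
  \<comment> \<open>If \<open>i\<close> held \<open>z\<close>, then \<open>j\<close> would hold
    \<open>y\<close>, which \<open>i\<close> prefers, so \<open>j\<close> would have to precede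
    \<open>i\<close>.\<close>
  have Mi: "M i = Some y"
  proof (rule ccontr)
    assume "M i \<noteq> Some y"
    then have "M i = Some z" using served acc(1) by blast
    then obtain k where k: "precedes p k i" "M k = Some y" using envy[of i y] pref by auto
    have "M j = Some y" using served[OF acc(2)] inj \<open>M i = Some z\<close> ij by blast
    then have "k = j" using inj k by blast
    then show False
      using k(1) first precedes_asym[of p i j] p by (auto simp: priority_orders_iff)
  qed
  then have Mj: "M j = Some z" using served[OF acc(2)] inj ij by blast
  \<comment> \<open>Nothing is left for \<open>c\<close> and \<open>d\<close>, and each envies the
    holder of an object he accepts.\<close>
  have "M c = None" "M d = None"
    using M_cases inj Mi Mj agents by (metis distinct_length_2_or_more)+
  then have "precedes p i c" "precedes p j d"
    using envy[of c y] envy[of d z] acc(3,4) inj Mi Mj by (metis acceptable_def)+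
  then show ?thesis using filter_mem_fork_orders p agents first by blast
qed

text \<open>Two orders supply the whole configuration: one that leaves \<open>x\<close> unassigned
  gives \<open>y\<close> and \<open>z\<close> as the objects of \<open>i\<close> and
  \<open>j\<close>; \<open>p\<close>, which leaves \<open>i\<close> unassigned, gives
  \<open>j\<close>, \<open>c\<close>, \<open>d\<close> as the holders of \<open>x\<close>,
  \<open>y\<close>, \<open>z\<close>. If no order leaves \<open>x\<close> unassigned, the
  probability is 0.\<close>

lemma unassigned_prob_RSD_le_quarter:
  fixes R :: "('i::finite, 'o::finite) profile"
  assumes R: "R \<in> profiles" and card: "CARD('o) = 3" and acc_i: "acceptable R i x"
    and p: "p \<in> priority_orders" "serial_dictatorship p R i = None"
  shows "unassigned_prob RSD R x \<le> 1 / 4"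
proof (cases "\<exists>q\<in>priority_orders. \<forall>k. serial_dictatorship q R k \<noteq> Some x")
  case False
  then have "measure_pmf.prob (pmf_of_set priority_orders)
      {q. \<forall>k. serial_dictatorship q R k \<noteq> Some x} = 0"
    by (auto simp: measure_pmf_of_set finite_priority_orders priority_orders_nonempty)
  then show ?thesis by (simp add: unassigned_prob_RSD[OF R])
next
  case True
  then obtain q where q: "q \<in> priority_orders" "\<And>k. serial_dictatorship q R k \<noteq> Some x"
    by blast
  define M where "M = serial_dictatorship p R"
  note envy = serial_dictatorship_envied_precedes[OF R p(1), folded M_def]
  have Mi: "M i = None" using p(2) by (simp add: M_def)
  obtain j where Mj: "M j = Some x" using envy[of i x] acc_i Mi by (auto simp: acceptable_def)
  have ij: "i \<noteq> j" using Mi Mj by auto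
  have acc_j: "acceptable R j x"
    using serial_dictatorship_acceptable[OF R] Mj by (simp add: M_def)
  \<comment> \<open>Under \<open>q\<close> nobody holds \<open>x\<close>, so nobody can prefer it to
    his outcome; an agent accepting \<open>x\<close> must hold a better object.\<close>
  have better: "\<exists>y. serial_dictatorship q R k = Some y \<and> strictly_prefers R k (Some y) (Some x)"
    if "acceptable R k x" for k
  proof -
    have "strictly_prefers R k (serial_dictatorship q R k) (Some x)"
      using strictly_prefers_linear[OF R] serial_dictatorship_envied_precedes[OF R q(1)] q(2)
      by metis
    then show ?thesis using that
      by (cases "serial_dictatorship q R k") (auto simp: acceptable_def strictly_prefers_def)
  qed
  obtain y where y: "serial_dictatorship q R i = Some y" "strictly_prefers R i (Some y) (Some x)"
    using better[OF acc_i] by blast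
  obtain z where z: "serial_dictatorship q R j = Some z" "strictly_prefers R j (Some z) (Some x)"
    using better[OF acc_j] by blast
  have yz: "y \<noteq> z" "y \<noteq> x" "z \<noteq> x"
    using serial_dictatorship_injective[OF R] y z q(2) ij by metis+
  then have "card {x, y, z} = 3" by auto
  then have objects: "(UNIV :: 'o set) = {x, y, z}"
    using card_seteq[of UNIV "{x, y, z}"] card by auto
  \<comment> \<open>Under \<open>p\<close>, \<open>i\<close> holds nothing although he accepts
    \<open>y\<close>, and \<open>j\<close> holds \<open>x\<close> although he prefers
    \<open>z\<close>; so both \<open>y\<close> and \<open>z\<close> have holders.\<close>
  obtain c where Mc: "M c = Some y"
    using envy[of i y] strictly_prefers_trans[OF R y(2)] acc_i Mi by (auto simp: acceptable_def)
  obtain d where Md: "M d = Some z"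
    using envy[of j z] z(2) Mj by auto
  have agents: "distinct [i, j, c, d]" using Mi Mj Mc Md yz by auto
  have acc: "acceptable R c y" "acceptable R d z"
    using serial_dictatorship_acceptable[OF R] Mc Md by (simp_all add: M_def)

  \<comment> \<open>\<open>k\<close> stands for the earlier of \<open>i\<close> and
    \<open>j\<close>. He takes his favourite of \<open>y\<close> and \<open>z\<close>, which decides
    whether he has to precede \<open>c\<close> or \<open>d\<close>; \<open>l\<close> has to precede
    the other.\<close>
  define L where "L k l = (if strictly_prefers R k (Some y) (Some z)
    then fork_orders k l c d else fork_orders k l d c)" for k l
  have sub: "filter (\<lambda>v. v \<in> {i, j, c, d}) r \<in> L k l"
    if "r \<in> priority_orders" "\<forall>m. serial_dictatorship r R m \<noteq> Some x"
      "precedes r k l" "(k, l) = (i, j) \<or> (k, l) = (j, i)" for r k l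
  proof -
    have set_eq: "{k, l, c, d} = {i, j, c, d}" "{k, l, d, c} = {i, j, c, d}"
      and "distinct [k, l, c, d]" "distinct [k, l, d, c]" "acceptable R k x" "acceptable R l x"
      using that(4) agents acc_i acc_j by auto
    moreover have "strictly_prefers R k (Some y) (Some z) \<or> strictly_prefers R k (Some z) (Some y)"
      using strictly_prefers_linear[OF R] yz(1) by (metis option.inject)
    moreover have "(UNIV :: 'o set) = {x, z, y}" using objects by auto
    ultimately show ?thesis
      using unassigned_imp_fork_order[OF R that(1,2) objects, of k l c d]
        unassigned_imp_fork_order[OF R that(1,2), of z y k l d c] acc that(3)
      unfolding L_def set_eq by presburger
  qed
  have "unassigned_prob RSD R x = measure_pmf.prob (pmf_of_set priority_orders)
     {r. r \<in> priority_orders \<and> (\<forall>k. serial_dictatorship r R k \<noteq> Some x)}"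
    unfolding unassigned_prob_RSD[OF R]
    by (rule prob_priority_orders_restrict[symmetric])
  also have "\<dots> \<le> measure_pmf.prob (pmf_of_set priority_orders)
     {r. filter (\<lambda>v. v \<in> {i, j, c, d}) r \<in> L i j \<union> L j i}"
  proof (intro measure_pmf.finite_measure_mono subsetI CollectI; (elim CollectE conjE)?)
    fix r assume r: "r \<in> priority_orders" "\<forall>k. serial_dictatorship r R k \<noteq> Some x"
    then have "precedes r i j \<or> precedes r j i"
      using precedes_total ij by (metis UNIV_I priority_orders_iff)
    then show "filter (\<lambda>v. v \<in> {i, j, c, d}) r \<in> L i j \<union> L j i"
      using sub r by blast
  qed simp
  also have "\<dots> = card (L i j \<union> L j i) / fact (card {i, j, c, d})"
  proof (rule prob_priority_orders_filter)
    show "L i j \<union> L j i \<subseteq> permutations_of_set {i, j, c, d}"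
      using agents by (auto simp: L_def fork_orders_def permutations_of_set_def)
  qed
  also have "\<dots> \<le> 6 / fact 4"
  proof -
    \<comment> \<open>Either branch of \<open>L\<close> has at most three lists, so the union covers
      at most six of the 4! = 24 relative orders.\<close>
    have card_L: "card (L k l) \<le> 3" for k l
      by (simp add: L_def fork_orders_def card_insert_le_m1)
    have "card (L i j \<union> L j i) \<le> 6"
      using card_Un_le[of "L i j" "L j i"] card_L[of i j] card_L[of j i] by linarith
    moreover have "card {i, j, c, d} = 4" using agents by auto
    ultimately show ?thesis by (simp add: divide_right_mono)
  qed
  finally show ?thesis by (simp add: fact_numeral)
qed

section \<open>A profile attaining the bound\<close>

lemma linear_order_inj_nat:
  fixes g :: "'a \<Rightarrow> nat"
  assumes "inj g"
  shows "linear_order {(u, v). g u \<le> g v}"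
  using assms by (auto simp: order_on_defs refl_on_def trans_def antisym_def total_on_def inj_def)

lemma object_wasteful_quarter_RSD:
  assumes "CARD('i::finite) \<ge> 4" and "CARD('o::finite) = 3"
  shows "object_wasteful (1 / 4) (RSD :: ('i, 'o) random_rule)"
proof -
  obtain I where "card I = 4" "I \<subseteq> (UNIV :: 'i set)"
    using obtain_subset_with_card_n[OF assms(1)] by blast
  then obtain i j c d :: 'i where "I = {i, j, c, d}" and agents: "distinct [i, j, c, d]"
    by (auto simp: card_Suc_eq numeral_eq_Suc)
  obtain x y z :: 'o where objects: "UNIV = {x, y, z}" and neq: "x \<noteq> y" "x \<noteq> z" "y \<noteq> z"
    using assms(2) by (auto simp: card_3_iff)
  \<comment> \<open>Ranks; every option outside the list shares the rank \<open>3\<close>, so a list may omit only one option.\<close>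
  define g :: "'i \<Rightarrow> 'o option \<Rightarrow> nat" where
    "g k u = length (takeWhile (\<lambda>v. v \<noteq> u)
      (if k = i then [Some y, Some x, None] else if k = j then [Some z, Some x, None]
       else if k = c then [Some y, None, Some x] else if k = d then [Some z, None, Some x]
       else [None, Some x, Some y]))" for k u
  define R :: "('i, 'o) profile" where "R k = {(u, v). g k u \<le> g k v}" for k
  have exhaust: "u = None \<or> u = Some x \<or> u = Some y \<or> u = Some z" for u
    using objects by (cases u) auto
  have "inj (g k)" for k
  proof (rule injI)
    fix u v assume "g k u = g k v"
    then show "u = v" using exhaust[of u] exhaust[of v] neq agents
      by (auto simp: g_def split: if_splits)
  qed
  then have R: "R \<in> profiles" by (simp add: profiles_def R_def linear_order_inj_nat)
  have sp: "strictly_prefers R k u v \<longleftrightarrow> g k u < g k v" for k u v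
    by (auto simp: strictly_prefers_def R_def)
  have acc_x: "acceptable R k x \<longleftrightarrow> k \<in> {i, j}"
    and acc_y: "acceptable R k y \<longleftrightarrow> k \<in> {i, c}"
    and acc_z: "acceptable R k z \<longleftrightarrow> k \<in> {j, d}" for k
    using neq agents by (auto simp: acceptable_def sp g_def)
  have top_y: "u = Some y \<or> strictly_prefers R k (Some y) u" if "k \<in> {i, c}" for k u
    using that neq agents exhaust[of u] by (auto simp: sp g_def)
  have top_z: "u = Some z \<or> strictly_prefers R k (Some z) u" if "k \<in> {j, d}" for k u
    using that neq agents exhaust[of u] by (auto simp: sp g_def)
  \<comment> \<open>A predecessor of \<open>k\<close> holding \<open>w\<close> would have to accept
    it, but the only rival of \<open>k\<close> for \<open>w\<close> is \<open>l\<close>, who comes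
    later.\<close>
  have get_top: "serial_dictatorship p R k = Some w"
    if p: "p \<in> priority_orders" and kl: "precedes p k l"
      and acc: "\<And>m. acceptable R m w \<longleftrightarrow> m \<in> {k, l}"
      and top: "\<And>u. u = Some w \<or> strictly_prefers R k (Some w) u" for p k l w
  proof (rule ccontr)
    assume "serial_dictatorship p R k \<noteq> Some w"
    then obtain m where m: "precedes p m k" "serial_dictatorship p R m = Some w"
      using serial_dictatorship_envied_precedes[OF R p] top by metis
    then have "m \<in> {k, l}" using serial_dictatorship_acceptable[OF R] acc by blast
    then show False
      using m(1) p kl precedes_asym[of p k] by (auto simp: priority_orders_iff)
  qed
  let ?P = "measure_pmf.prob (pmf_of_set (priority_orders :: 'i list set))"
  \<comment> \<open>Under the orders in \<open>?A\<close>, \<open>i\<close> and \<open>j\<close>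
    take \<open>y\<close> and \<open>z\<close> and leave \<open>x\<close>; under those in
    \<open>?B\<close>, \<open>c\<close> and \<open>d\<close> take \<open>y\<close> and
    \<open>z\<close>, so that only \<open>x\<close> remains for \<open>i\<close> and
    \<open>j\<close>.\<close>
  let ?A = "{p \<in> priority_orders. filter (\<lambda>v. v \<in> {i, c, j, d}) p \<in> interleavings i c j d}"
  let ?B = "{p \<in> priority_orders. filter (\<lambda>v. v \<in> {c, i, d, j}) p \<in> interleavings c i d j}"
  have PA: "?P ?A = 1 / 4" and PB: "?P ?B = 1 / 4"
    unfolding prob_priority_orders_restrict using agents by (intro prob_interleavings; auto)+
  have "?P ?A \<le> ?P {p. \<forall>k. serial_dictatorship p R k \<noteq> Some x}"
  proof (intro measure_pmf.finite_measure_mono subsetI CollectI allI notI; (elim CollectE conjE)?)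
    fix p k
    assume p: "p \<in> priority_orders"
      and fl: "filter (\<lambda>v. v \<in> {i, c, j, d}) p \<in> interleavings i c j d"
      and x: "serial_dictatorship p R k = Some x"
    have "serial_dictatorship p R i = Some y" "serial_dictatorship p R j = Some z"
      using get_top[OF p, of i c y] get_top[OF p, of j d z] acc_y acc_z top_y top_z
        filter_mem_interleavings[OF fl] by blast+
    moreover have "k \<in> {i, j}" using serial_dictatorship_acceptable[OF R x] acc_x by blast
    ultimately show False using x neq by auto
  qed simp
  then have U: "unassigned_prob RSD R x \<ge> 1 / 4" unfolding PA unassigned_prob_RSD[OF R] .
  have "?P ?B \<le> ?P ({p. serial_dictatorship p R i = None} \<union> {p. serial_dictatorship p R j = None})"
  proof (intro measure_pmf.finite_measure_mono subsetI; (elim CollectE conjE)?)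
    fix p
    assume p: "p \<in> priority_orders"
      and fl: "filter (\<lambda>v. v \<in> {c, i, d, j}) p \<in> interleavings c i d j"
    have "serial_dictatorship p R c = Some y" "serial_dictatorship p R d = Some z"
      using get_top[OF p, of c i y] get_top[OF p, of d j z] acc_y acc_z top_y top_z
        filter_mem_interleavings[OF fl] by blast+
    then have "serial_dictatorship p R k \<in> {None, Some x}" if "k \<in> {i, j}" for k
      using that serial_dictatorship_injective[OF R] agents
        exhaust[of "serial_dictatorship p R k"] by auto
    \<comment> \<open>\<open>x\<close> goes to at most one of \<open>i\<close> and \<open>j\<close>,
      so the other is unassigned.\<close>
    from this[of i] this[of j]
    show "p \<in> {p. serial_dictatorship p R i = None} \<union> {p. serial_dictatorship p R j = None}"
      using serial_dictatorship_injective[OF R, of p i x j] agents by auto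
  qed simp
  also have "\<dots> \<le> assign_prob RSD R i None + assign_prob RSD R j None"
    unfolding assign_prob_RSD by (intro measure_Un_le) auto
  also have "\<dots> = (\<Sum>k | acceptable R k x. assign_prob RSD R k None)"
  proof -
    have "{k. acceptable R k x} = {i, j}" using acc_x by auto
    then show ?thesis using agents by simp
  qed
  finally show ?thesis
    unfolding object_wasteful_def PB using U by (intro bexI[OF _ R] exI[of _ x]) simp
qed

section \<open>Combining the two bounds\<close>

theorem lemma2:
  assumes "CARD('i::finite) \<ge> 4" and "CARD('o::finite) = 3"
  shows "at_most_object_wasteful (1/4) (RSD :: ('i, 'o) random_rule)"
  unfolding at_most_object_wasteful_def
proof (intro conjI allI impI notI)
  show "object_wasteful (1/4) (RSD :: ('i, 'o) random_rule)"
    using object_wasteful_quarter_RSD assms by blast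
next
  fix q :: real
  assume q: "1/4 < q \<and> q \<le> 1" and "object_wasteful q (RSD :: ('i, 'o) random_rule)"
  then obtain R :: "('i, 'o) profile" and x where R: "R \<in> profiles"
    and W: "(\<Sum>i | acceptable R i x. assign_prob RSD R i None) \<ge> q"
    and U: "unassigned_prob RSD R x \<ge> q"
    unfolding object_wasteful_def by auto
  \<comment> \<open>A nonzero sum has a nonzero term: some agent accepting \<open>x\<close> is
    unassigned under some order. This alone caps the probability that \<open>x\<close> is unassigned
    at 1/4, below \<open>q\<close>.\<close>
  have "(\<Sum>i | acceptable R i x. assign_prob RSD R i None) \<noteq> 0" using W q by linarith
  then obtain i where i: "acceptable R i x" "assign_prob RSD R i None \<noteq> 0"
    by (metis (mono_tags, lifting) mem_Collect_eq sum.neutral)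
  then obtain p where "p \<in> priority_orders" "serial_dictatorship p R i = None"
    by (auto simp: assign_prob_RSD measure_pmf_of_set finite_priority_orders
        priority_orders_nonempty card_gt_0_iff)
  then have "unassigned_prob RSD R x \<le> 1/4"
    using unassigned_prob_RSD_le_quarter R assms(2) i(1) by blast
  then show False using U q by linarith
qed

end
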